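(* Let $m\in\mathbb{N}$ and $M_k\ge 0$ for $k=0,1,\ldots,m-1$. Let $F(z)=\sum_{k=0}^{m-1}\overline{z}^k f_k(z)$ be a poly-analytic function of order $m$ in the unit disk $\mathbb{D}$, where all the $f_k$ are holomorphic in $\mathbb{D}$, satisfying $F_z(0)=1$, $f_k(0)=0$ for $k\in\{0,1,2,\ldots,m-1\}$, and $f_k'(0)=1$ for $k=1,2,\ldots,m-1$. If $|f_k(z)|\le M_k$ for all $k\in\{0,1,2,\ldots,m-1\}$ and all $z\in\mathbb{D}$, then $M_k\ge 1$ for all $k\in\{0,1,2,\ldots,m-1\}$, and $F$ is sense-preserving, univalent and fully starlike in the disk $\mathbb{D}_{r_4}$, where $r_4$ is the unique root in $(0,1)$ of the equation $$1-\sum_{k=0}^{m-1}\left(M_k-\frac{1}{M_k}\right)\frac{r^{k+1}\bigl(2-r+k(1-r)\bigr)}{(1-r)^2}-\sum_{k=1}^{m-1}(k+1)r^k=0.$$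
   Context: $\mathbb{D}_r=\{z\in\mathbb{C}:|z|<r\}$ and $\mathbb{D}=\mathbb{D}_1$; $\mathbb{N}=\{1,2,\ldots\}$. A poly-analytic function of order $m$ in a domain $\Omega$ is a function of the form $F(z)=\sum_{k=0}^{m-1}\overline{z}^k f_k(z)$ with all $f_k$ analytic in $\Omega$. $F_z$ and $F_{\overline z}$ denote the Wirtinger derivatives $\frac12(F_x-iF_y)$ and $\frac12(F_x+iF_y)$. Univalent means injective. A continuously differentiable function $F$ is sense-preserving in a domain if its Jacobian $J_F(z)=|F_z(z)|^2-|F_{\overline z}(z)|^2$ is positive there. A continuously differentiable function $F$ on $\mathbb{D}_R$ is fully starlike in $\mathbb{D}_R$ if it is sense-preserving, $F(0)=0$, $F(z)\ne 0$ for $z\in\mathbb{D}_R\setminus\{0\}$, and for each $0<\rho<R$ the curve $t\mapsto F(\rho e^{it})$ is starlike with respect to the origin, the last condition meaning $$\frac{\partial}{\partial t}\arg F(\rho e^{it})=\operatorname{Re}\left(\frac{zF_z(z)-\overline{z}F_{\overline z}(z)}{F(z)}\right)>0\quad\text{for all } z=\rho e^{it},\ 0<\rho<R.$$ Empty sums are $0$.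
   Formalization: When m=1 and M_0=1 (so F(z)=z) the equation reads 1=0 and r_4 does not exist; existence and uniqueness of the root are therefore claimed only outside this case, and the properties of F are claimed in the disk given by any root in (0,1). *)

theory Defs
  imports "HOL-Complex_Analysis.Complex_Analysis"
begin

text \<open>
  For a real-differentiable \<open>F\<close>, the partial derivatives \<open>F\<^sub>x\<close> and \<open>F\<^sub>y\<close> at \<open>z\<close> are the values of the
  (real-linear) Frechet derivative in the directions \<open>1\<close> and \<open>\<i>\<close>.
\<close>

definition wirtinger_z :: "(complex \<Rightarrow> complex) \<Rightarrow> complex \<Rightarrow> complex" where
  "wirtinger_z F z =
     (frechet_derivative F (at z) 1 - \<i> * frechet_derivative F (at z) \<i>) / 2"

definition wirtinger_zbar :: "(complex \<Rightarrow> complex) \<Rightarrow> complex \<Rightarrow> complex" where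
  "wirtinger_zbar F z =
     (frechet_derivative F (at z) 1 + \<i> * frechet_derivative F (at z) \<i>) / 2"

definition jacobian_det :: "(complex \<Rightarrow> complex) \<Rightarrow> complex \<Rightarrow> real" where
  "jacobian_det F z = (cmod (wirtinger_z F z))\<^sup>2 - (cmod (wirtinger_zbar F z))\<^sup>2"

definition cont_differentiable_on :: "(complex \<Rightarrow> complex) \<Rightarrow> complex set \<Rightarrow> bool" where
  "cont_differentiable_on F \<Omega> \<longleftrightarrow>
     (\<forall>z\<in>\<Omega>. F differentiable (at z)) \<and>
     continuous_on \<Omega> (\<lambda>z. frechet_derivative F (at z) 1) \<and>
     continuous_on \<Omega> (\<lambda>z. frechet_derivative F (at z) \<i>)"

definition sense_preserving_on :: "(complex \<Rightarrow> complex) \<Rightarrow> complex set \<Rightarrow> bool" where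
  "sense_preserving_on F \<Omega> \<longleftrightarrow>
     cont_differentiable_on F \<Omega> \<and> (\<forall>z\<in>\<Omega>. jacobian_det F z > 0)"

text \<open>
  The expression in the last conjunct is the derivative of \<open>arg F(\<rho> e\<^sup>i\<^sup>t)\<close> with respect to \<open>t\<close>; its
  positivity says that the image of the circle of radius \<open>\<rho>\<close> is starlike with respect to the origin.
\<close>

definition fully_starlike :: "(complex \<Rightarrow> complex) \<Rightarrow> real \<Rightarrow> bool" where
  "fully_starlike F R \<longleftrightarrow>
     sense_preserving_on F (ball 0 R) \<and>
     F 0 = 0 \<and>
     (\<forall>z\<in>ball 0 R - {0}. F z \<noteq> 0) \<and>
     (\<forall>\<rho> t. 0 < \<rho> \<and> \<rho> < R \<longrightarrow>
        (let z = complex_of_real \<rho> * cis t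
         in Re ((z * wirtinger_z F z - cnj z * wirtinger_zbar F z) / F z) > 0))"

text \<open>
  For \<open>m = 1\<close> and \<open>M 0 = 1\<close> this is the constant \<open>1\<close> and has no root; in all other cases
  with \<open>m \<ge> 1\<close> and \<open>M k \<ge> 1\<close> it has exactly one root in the open interval from 0 to 1.
\<close>

definition radius_fun :: "nat \<Rightarrow> (nat \<Rightarrow> real) \<Rightarrow> real \<Rightarrow> real" where
  "radius_fun m M r =
     1 - (\<Sum>k<m. (M k - 1 / M k) * (r ^ (k + 1) * (2 - r + real k * (1 - r)) / (1 - r)\<^sup>2))
       - (\<Sum>k\<in>{1..<m}. (real k + 1) * r ^ k)"

end

theory Submission
  imports Defs
begin

text \<open>
  The coefficients \<open>a\<^sub>n\<close>, \<open>n \<ge> 2\<close>, of a holomorphic \<open>f\<close> on the unit disk with \<open>f(0) = 0\<close>,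
  \<open>f'(0) = 1\<close> and \<open>\<bar>f\<bar> \<le> M\<close> satisfy \<open>\<bar>a\<^sub>n\<bar> \<le> M - 1/M\<close>. Summing these bounds over all monomials
  of \<open>F\<close> other than \<open>z\<close> shows, with \<open>r = \<bar>z\<bar>\<close> and \<open>\<Phi>\<close> the left-hand side of the radius equation,
  that both \<open>r (\<bar>F\<^sub>z - 1\<bar> + \<bar>F\<^bsub>z'\<^esub>\<bar>)\<close> and \<open>\<bar>z F\<^sub>z - z' F\<^bsub>z'\<^esub> - F\<bar> + \<bar>F - z\<bar>\<close> are at most
  \<open>r (1 - \<Phi>(r))\<close>, where \<open>z'\<close> is the conjugate of \<open>z\<close>. Since \<open>\<Phi>\<close> decreases strictly from
  \<open>\<Phi>(0) = 1\<close>, below its root the map \<open>F - id\<close> is a local contraction, so that \<open>F\<close> is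
  sense-preserving and injective, and \<open>z F\<^sub>z - z' F\<^bsub>z'\<^esub>\<close> lies within distance \<open>\<bar>F\<bar>\<close> of \<open>F\<close>, so that
  their quotient has positive real part.
\<close>

section \<open>Coefficient bounds for bounded holomorphic functions on the disk\<close>

text \<open>Parseval for a binomial: expanding the square leaves the cross term 2 Re (\<beta> u^N),
  whose mean vanishes by Cauchy's formula because u^N is zero at the origin.\<close>

lemma circle_mean_square:
  assumes "0 < \<rho>" "0 < N"
  shows "((\<lambda>t. (cmod (1 + \<beta> * circlepath 0 \<rho> t ^ N))\<^sup>2) has_integral
           (1 + (cmod \<beta>)\<^sup>2 * \<rho> ^ (2 * N))) {0..1}"
proof -
  have "((\<lambda>u. u ^ N / (u - 0) ^ Suc 0) has_contour_integral
          (2 * pi * \<i>) / fact 0 * (deriv ^^ 0) (\<lambda>u. u ^ N) 0) (circlepath 0 \<rho>)"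
    by (rule Cauchy_has_contour_integral_higher_derivative_circlepath)
      (use assms in \<open>auto intro!: continuous_intros holomorphic_intros\<close>)
  then have "((\<lambda>u. u ^ N / u) has_contour_integral 0) (circlepath 0 \<rho>)"
    using assms by (simp add: zero_power)
  then have "((\<lambda>t. circlepath 0 \<rho> t ^ N / circlepath 0 \<rho> t *
      (2 * pi * \<i> * \<rho> * exp (2 * of_real pi * \<i> * t))) has_integral 0) {0..1}"
    unfolding has_contour_integral_def
    by (rule has_integral_eq[rotated]) (simp add: vector_derivative_circlepath01)
  then have "((\<lambda>t. circlepath 0 \<rho> t ^ N * (2 * pi * \<i>)) has_integral 0) {0..1}"
    by (rule has_integral_eq[rotated]) (use assms in \<open>simp add: circlepath\<close>)
  then have "((\<lambda>t. circlepath 0 \<rho> t ^ N * (2 * pi * \<i>) * (\<beta> / (pi * \<i>))) has_integral 0 * (\<beta> / (pi * \<i>))) {0..1}"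
    by (rule has_integral_mult_left)
  then have "((\<lambda>t. 2 * (\<beta> * circlepath 0 \<rho> t ^ N)) has_integral 0) {0..1}"
    by (simp add: field_simps)
  from has_integral_linear[OF this bounded_linear_Re]
  have "((\<lambda>t. 2 * Re (\<beta> * circlepath 0 \<rho> t ^ N)) has_integral 0) {0..1}"
    by (simp add: o_def)
  moreover have "((\<lambda>t. 1 + (cmod \<beta>)\<^sup>2 * \<rho> ^ (2 * N)) has_integral (1 + (cmod \<beta>)\<^sup>2 * \<rho> ^ (2 * N))) {0..1::real}"
    using has_integral_const_real[of "1 + (cmod \<beta>)\<^sup>2 * \<rho> ^ (2 * N)" 0 1] by simp
  ultimately have "((\<lambda>t. 1 + (cmod \<beta>)\<^sup>2 * \<rho> ^ (2 * N) + 2 * Re (\<beta> * circlepath 0 \<rho> t ^ N))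
      has_integral (1 + (cmod \<beta>)\<^sup>2 * \<rho> ^ (2 * N))) {0..1}"
    by (metis (no_types, lifting) ext has_integral_add add.right_neutral)
  moreover have "(cmod (1 + \<beta> * circlepath 0 \<rho> t ^ N))\<^sup>2 =
      1 + (cmod \<beta>)\<^sup>2 * \<rho> ^ (2 * N) + 2 * Re (\<beta> * circlepath 0 \<rho> t ^ N)" for t
  proof -
    have n: "cmod (\<beta> * circlepath 0 \<rho> t ^ N) = cmod \<beta> * \<rho> ^ N"
      using assms by (simp add: circlepath norm_mult norm_power)
    have "(cmod (1 + w))\<^sup>2 = 1 + (cmod w)\<^sup>2 + 2 * Re w" for w
      unfolding cmod_power2 by (simp add: power2_eq_square algebra_simps)
    from this[of "\<beta> * circlepath 0 \<rho> t ^ N"] show ?thesis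
      unfolding n by (simp only: power_mult_distrib power_mult[symmetric] mult.commute[of N])
  qed
  ultimately show ?thesis by simp
qed

text \<open>
  With \<open>p = 1 + \<beta> z\<^sup>N\<close>, the left-hand side is the coefficient of \<open>z\<^sup>N\<^sup>+\<^sup>1\<close> in \<open>f p\<^sup>2\<close>, hence at most
  \<open>M\<close> times the mean of \<open>\<bar>p\<bar>\<^sup>2\<close> on the unit circle. A suitable \<open>\<beta>\<close> of modulus \<open>\<bar>f'(0)\<bar> / M\<close>
  then gives the sharp bound of the next lemma.
\<close>

lemma bounded_disk_coeff_test:
  fixes f :: "complex \<Rightarrow> complex"
  assumes hol: "f holomorphic_on ball 0 1" and f0: "f 0 = 0"
    and bd: "\<And>z. z \<in> ball 0 1 \<Longrightarrow> cmod (f z) \<le> M" and N: "0 < N"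
  shows "cmod ((deriv ^^ Suc N) f 0 / fact (Suc N) + 2 * \<beta> * deriv f 0) \<le> M * (1 + (cmod \<beta>)\<^sup>2)"
proof -
  define L where "L = (deriv ^^ Suc N) f 0 / fact (Suc N) + 2 * \<beta> * deriv f 0"
  have M: "0 \<le> M" using bd[of 0] f0 by simp
  \<comment> \<open>Cauchy's formula is applied on circles of radius \<rho> < 1, as nothing is
    assumed about \<open>f\<close> on the unit circle; \<rho> tends to 1 at the end.\<close>
  have main: "\<rho> ^ Suc N * cmod L \<le> M * (1 + (cmod \<beta>)\<^sup>2)" if \<rho>: "0 < \<rho>" "\<rho> < 1" for \<rho>
  proof -
    have holb: "f holomorphic_on ball 0 \<rho>" and cont: "continuous_on (cball 0 \<rho>) f"
      using \<rho> by (auto intro!: holomorphic_on_imp_continuous_on holomorphic_on_subset[OF hol])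
    have I: "((\<lambda>u. f u / u ^ Suc k) has_contour_integral
        (2 * pi * \<i>) / fact k * (deriv ^^ k) f 0) (circlepath 0 \<rho>)" for k
      using Cauchy_has_contour_integral_higher_derivative_circlepath[OF cont holb, of 0 k] \<rho> by simp
    \<comment> \<open>This is the \<beta>^2 term of the expansion below. Its integral is governed by
      the value of f(u) u^(N-1) at 0, which vanishes since f(0) = 0. Writing u^(N-2) as u^(N-1) / u
      also covers N = 1.\<close>
    have J: "((\<lambda>u. (f u * u ^ (N - 1)) / (u - 0) ^ Suc 0) has_contour_integral
        (2 * pi * \<i>) / fact 0 * (deriv ^^ 0) (\<lambda>u. f u * u ^ (N - 1)) 0) (circlepath 0 \<rho>)"
      by (rule Cauchy_has_contour_integral_higher_derivative_circlepath)
        (use \<rho> in \<open>auto intro!: continuous_intros holomorphic_intros cont holb\<close>)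
    \<comment> \<open>The integrand is f(u) (1 + \<beta> u^N)^2 / u^(N+2), expanded. The
      parametrisation du = 2 pi i u dt then lowers the exponent of the denominator to N + 1.\<close>
    have "((\<lambda>u. f u / u ^ Suc (Suc N) + 2 * \<beta> * (f u / u ^ Suc 1) + \<beta>\<^sup>2 * (f u * u ^ (N - 1) / u))
        has_contour_integral
        ((2 * pi * \<i>) / fact (Suc N) * (deriv ^^ Suc N) f 0
          + 2 * \<beta> * ((2 * pi * \<i>) / fact 1 * (deriv ^^ 1) f 0) + \<beta>\<^sup>2 * 0)) (circlepath 0 \<rho>)"
      using J f0 by (intro has_contour_integral_add has_contour_integral_lmul I) auto
    also have "(2 * pi * \<i>) / fact (Suc N) * (deriv ^^ Suc N) f 0
          + 2 * \<beta> * ((2 * pi * \<i>) / fact 1 * (deriv ^^ 1) f 0) + \<beta>\<^sup>2 * 0 = 2 * pi * \<i> * L"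
      by (simp add: L_def algebra_simps)
    finally have "((\<lambda>t. f (circlepath 0 \<rho> t) * (1 + \<beta> * circlepath 0 \<rho> t ^ N)\<^sup>2
        / circlepath 0 \<rho> t ^ Suc N * (2 * pi * \<i>)) has_integral 2 * pi * \<i> * L) {0..1}"
      unfolding has_contour_integral_def
    proof (rule has_integral_eq[rotated], goal_cases)
      case (1 t)
      obtain N' where N': "N = Suc N'" using N by (cases N) auto
      define u where "u = circlepath 0 \<rho> t"
      have u0: "u \<noteq> 0" using \<rho> by (simp add: u_def circlepath)
      have v: "vector_derivative (circlepath 0 \<rho>) (at t within {0..1}) = 2 * pi * \<i> * u"
        using 1 vector_derivative_circlepath01[of t 0 \<rho>] by (simp add: u_def circlepath del: vector_derivative_circlepath01)
      show ?case unfolding v u_def[symmetric] N'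
        using u0 by (simp add: field_simps power2_eq_square)
    qed
    from has_integral_mult_left[OF this, of "1 / (2 * pi * \<i>)"]
    have int: "((\<lambda>t. f (circlepath 0 \<rho> t) * (1 + \<beta> * circlepath 0 \<rho> t ^ N)\<^sup>2
        / circlepath 0 \<rho> t ^ Suc N) has_integral L) {0..1}"
      by simp
    have sq: "((\<lambda>t. M / \<rho> ^ Suc N * (cmod (1 + \<beta> * circlepath 0 \<rho> t ^ N))\<^sup>2)
        has_integral M / \<rho> ^ Suc N * (1 + (cmod \<beta>)\<^sup>2 * \<rho> ^ (2 * N))) {0..1}"
      by (rule has_integral_mult_right[OF circle_mean_square[OF \<rho>(1) N]])
    have "cmod (f (circlepath 0 \<rho> t) * (1 + \<beta> * circlepath 0 \<rho> t ^ N)\<^sup>2 / circlepath 0 \<rho> t ^ Suc N)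
       \<le> M / \<rho> ^ Suc N * (cmod (1 + \<beta> * circlepath 0 \<rho> t ^ N))\<^sup>2" for t
    proof -
      have c: "cmod (circlepath 0 \<rho> t) = \<rho>" using \<rho> by (simp add: circlepath norm_mult)
      then have "cmod (f (circlepath 0 \<rho> t)) \<le> M" using \<rho> by (intro bd) simp
      then show ?thesis using \<rho>
        by (simp add: norm_mult norm_divide norm_power c divide_right_mono mult_right_mono)
    qed
    then have "cmod L \<le> M / \<rho> ^ Suc N * (1 + (cmod \<beta>)\<^sup>2 * \<rho> ^ (2 * N))"
      using Henstock_Kurzweil_Integration.integral_norm_bound_integral[OF has_integral_integrable[OF int] has_integral_integrable[OF sq]]
      by (simp only: integral_unique[OF int] integral_unique[OF sq])
    then have "\<rho> ^ Suc N * cmod L \<le> M * (1 + (cmod \<beta>)\<^sup>2 * \<rho> ^ (2 * N))"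
      using \<rho> by (simp add: field_simps)
    also have "\<dots> \<le> M * (1 + (cmod \<beta>)\<^sup>2 * 1)"
      using \<rho> M by (intro mult_left_mono add_left_mono power_le_one) auto
    finally show ?thesis by simp
  qed
  have "((\<lambda>\<rho>. \<rho> ^ Suc N * cmod L) \<longlongrightarrow> 1 ^ Suc N * cmod L) (at_left 1)"
    by (intro tendsto_intros)
  moreover have "eventually (\<lambda>\<rho>::real. \<rho> ^ Suc N * cmod L \<le> M * (1 + (cmod \<beta>)\<^sup>2)) (at_left 1)"
    by (rule eventually_mono[OF eventually_at_left_real[of 0 1]]) (use main in auto)
  ultimately show ?thesis
    unfolding L_def[symmetric] using tendsto_upperbound[of "\<lambda>\<rho>. \<rho> ^ Suc N * cmod L"] by force
qed

lemma bounded_disk_coeff_le: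
  fixes f :: "complex \<Rightarrow> complex"
  assumes hol: "f holomorphic_on ball 0 1" and f0: "f 0 = 0" and M: "0 < M"
    and bd: "\<And>z. z \<in> ball 0 1 \<Longrightarrow> cmod (f z) \<le> M" and n: "2 \<le> n"
  shows "cmod ((deriv ^^ n) f 0 / fact n) \<le> M - (cmod (deriv f 0))\<^sup>2 / M"
proof -
  obtain N where N: "n = Suc N" "0 < N" using n by (cases n) auto
  define a where "a = (deriv ^^ n) f 0 / fact n"
  define d where "d = deriv f 0"
  obtain u :: complex where u: "cmod u = 1" "a = cmod a * u"
  proof (cases "a = 0")
    case False
    then show ?thesis by (intro that[of "sgn a"]) (auto simp: norm_sgn sgn_div_norm norm_divide scaleR_conv_of_real field_simps)
  qed (auto intro: that[of 1])
  \<comment> \<open>The argument of \<beta> aligns 2 \<beta> d with \<open>a\<close>, so that their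
    moduli add; the modulus |d| / M minimises M (1 + |\<beta>|^2) - 2 |\<beta>| |d|.\<close>
  define \<beta> where "\<beta> = cnj d * u / M"
  have nb: "cmod \<beta> = cmod d / M" using M by (simp add: \<beta>_def norm_mult norm_divide u(1))
  have "a + 2 * \<beta> * d = cmod a * u + 2 * (d * cnj d) * u / M"
    by (subst u(2)) (simp add: \<beta>_def mult_ac)
  also have "\<dots> = of_real (cmod a + 2 * (cmod d)\<^sup>2 / M) * u"
    by (simp add: complex_norm_square[symmetric] algebra_simps)
  finally have "cmod (a + 2 * \<beta> * d) = cmod a + 2 * (cmod d)\<^sup>2 / M"
    using M by (simp only: norm_mult u(1) norm_of_real) simp
  moreover have "cmod (a + 2 * \<beta> * d) \<le> M * (1 + (cmod \<beta>)\<^sup>2)"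
    unfolding a_def d_def N(1) by (rule bounded_disk_coeff_test[OF hol f0 bd N(2)])
  moreover have "M * (1 + (cmod \<beta>)\<^sup>2) = M + (cmod d)\<^sup>2 / M"
    unfolding nb using M by (simp add: field_simps power2_eq_square)
  ultimately show ?thesis unfolding a_def[symmetric] d_def[symmetric] by linarith
qed

text \<open>The coefficient bound at n = 2 cannot be negative, which forces |f'(0)|^2 \<le> M^2. The
  case M = 0 is separate because that bound divides by M. With f'(0) = 1 this becomes the claim M_k
  \<ge> 1 of the theorem.\<close>

lemma bounded_disk_deriv_le:
  fixes f :: "complex \<Rightarrow> complex"
  assumes hol: "f holomorphic_on ball 0 1" and f0: "f 0 = 0"
    and bd: "\<And>z. z \<in> ball 0 1 \<Longrightarrow> cmod (f z) \<le> M"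
  shows "cmod (deriv f 0) \<le> M"
proof (cases "M = 0")
  case True
  have "eventually (\<lambda>z. f z = 0) (nhds 0)"
    using eventually_nhds_in_open[of "ball 0 1" 0] by (rule eventually_mono) (use bd True in auto)
  then have "deriv f 0 = deriv (\<lambda>_. 0) 0"
    by (rule deriv_cong_ev) simp
  then show ?thesis by (simp add: True)
next
  case False
  then have M: "0 < M" using bd[of 0] f0 by simp
  have "0 \<le> cmod ((deriv ^^ 2) f 0 / fact 2)" by simp
  also have "\<dots> \<le> M - (cmod (deriv f 0))\<^sup>2 / M"
    by (rule bounded_disk_coeff_le[OF hol f0 M bd]) auto
  finally have "(cmod (deriv f 0))\<^sup>2 / M \<le> M" by simp
  then have "(cmod (deriv f 0))\<^sup>2 \<le> M\<^sup>2"
    using M by (simp only: pos_divide_le_eq power2_eq_square)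
  then show ?thesis by (rule power2_le_imp_le) (use M in simp)
qed

section \<open>Estimates for power series from degree two on\<close>

text \<open>For |r| < 1 this is the sum of (n + k) r^n over n \<ge> 2. The weight n + k comes from
  the monomial cnj z^k z^n: its two Wirtinger derivatives bring down the factors n and k.\<close>

definition tail_bound :: "nat \<Rightarrow> real \<Rightarrow> real" where
  "tail_bound k r = r\<^sup>2 * (1 / (1 - r)\<^sup>2 + (real k + 1) / (1 - r))"

lemma tail_bound_sums:
  assumes "\<bar>r\<bar> < 1"
  shows "(\<lambda>n. (real n + 2 + real k) * r ^ (n + 2)) sums tail_bound k r"
proof -
  \<comment> \<open>The weight is split as (n + 1) + (k + 1), a differentiated geometric series plus
    a plain one.\<close>
  have "(\<lambda>n. r\<^sup>2 * (of_nat (Suc n) * r ^ n + (real k + 1) * r ^ n)) sums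
      (r\<^sup>2 * (1 / (1 - r)\<^sup>2 + (real k + 1) * (1 / (1 - r))))"
    using assms by (intro sums_mult sums_add geometric_deriv_sums geometric_sums) auto
  then show ?thesis
    by (simp add: tail_bound_def power_add power2_eq_square algebra_simps)
qed

lemma norm_add_norm_sums_le:
  fixes A B :: "nat \<Rightarrow> 'a :: real_normed_vector"
  assumes "A sums a" "B sums b" "C sums c" "\<And>n. norm (A n) + norm (B n) \<le> C n"
  shows "norm a + norm b \<le> c"
proof (rule LIMSEQ_le)
  show "(\<lambda>n. norm (\<Sum>i<n. A i) + norm (\<Sum>i<n. B i)) \<longlonglongrightarrow> norm a + norm b"
    using assms(1,2) unfolding sums_def by (intro tendsto_intros)
  show "(\<lambda>n. \<Sum>i<n. C i) \<longlonglongrightarrow> c"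
    using assms(3) unfolding sums_def .
  have "norm (\<Sum>i<n. A i) + norm (\<Sum>i<n. B i) \<le> (\<Sum>i<n. C i)" for n
  proof -
    have "norm (\<Sum>i<n. A i) + norm (\<Sum>i<n. B i) \<le> (\<Sum>i<n. norm (A i)) + (\<Sum>i<n. norm (B i))"
      by (intro add_mono norm_sum)
    also have "\<dots> \<le> (\<Sum>i<n. C i)"
      unfolding sum.distrib[symmetric] by (intro sum_mono assms)
    finally show ?thesis .
  qed
  then show "\<exists>N. \<forall>n\<ge>N. norm (\<Sum>i<n. A i) + norm (\<Sum>i<n. B i) \<le> (\<Sum>i<n. C i)" by blast
qed

lemma power_series_tail:
  assumes hol: "f holomorphic_on ball 0 1" and f0: "f 0 = 0" and f1: "deriv f 0 = 1"
    and z: "cmod z < 1"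
  shows "(\<lambda>n. (deriv ^^ (n + 2)) f 0 / fact (n + 2) * z ^ (n + 2)) sums (f z - z)"
    and "(\<lambda>n. of_nat (n + 2) * ((deriv ^^ (n + 2)) f 0 / fact (n + 2)) * z ^ (n + 2))
           sums (z * deriv f z - z)"
proof -
  have zb: "z \<in> ball 0 1" using z by simp
  have "(\<lambda>n. (deriv ^^ n) f 0 / fact n * z ^ n) sums f z"
    using holomorphic_power_series[OF hol zb] by simp
  from sums_split_initial_segment[OF this, of 2]
  show "(\<lambda>n. (deriv ^^ (n + 2)) f 0 / fact (n + 2) * z ^ (n + 2)) sums (f z - z)"
    by (simp add: numeral_2_eq_2 f0 f1)
  have "deriv f holomorphic_on ball 0 1" by (intro holomorphic_deriv hol open_ball)
  from holomorphic_power_series[OF this zb]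
  have "(\<lambda>n. (deriv ^^ Suc n) f 0 / fact n * z ^ n) sums deriv f z"
    by (simp add: funpow_swap1)
  from sums_split_initial_segment[OF this, of 1]
  have "(\<lambda>n. (deriv ^^ (n + 2)) f 0 / fact (n + 1) * z ^ (n + 1)) sums (deriv f z - 1)"
    by (simp add: f1)
  from sums_mult[OF this, of z]
  have s: "(\<lambda>n. z * ((deriv ^^ (n + 2)) f 0 / fact (n + 1) * z ^ (n + 1))) sums (z * deriv f z - z)"
    by (simp add: algebra_simps)
  have "z * (d / fact (n + 1) * z ^ (n + 1)) = of_nat (n + 2) * (d / fact (n + 2)) * z ^ (n + 2)"
    for n and d :: complex
  proof -
    have "fact (n + 2) = of_nat (n + 2) * (fact (n + 1) :: complex)"
      by (metis add_2_eq_Suc' Suc_eq_plus1 fact_Suc)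
    moreover have "of_nat (n + 2) \<noteq> (0 :: complex)" by (simp only: of_nat_eq_0_iff)
    ultimately show ?thesis by (simp del: of_nat_add of_nat_Suc fact_Suc)
  qed
  with s show "(\<lambda>n. of_nat (n + 2) * ((deriv ^^ (n + 2)) f 0 / fact (n + 2)) * z ^ (n + 2))
           sums (z * deriv f z - z)"
    by simp
qed

text \<open>Both estimates compare coefficients of z^n for n \<ge> 2, where |a_n| \<le> M - 1/M. The
  multipliers are n and k in the first, n - k - 1 and 1 in the second, and |n - k - 1| + 1 \<le> n +
  k, so the same majorant serves for the Jacobian and for starlikeness.\<close>

lemma bounded_disk_tail_estimates:
  assumes hol: "f holomorphic_on ball 0 1" and f0: "f 0 = 0" and f1: "deriv f 0 = 1"
    and bd: "\<And>z. z \<in> ball 0 1 \<Longrightarrow> cmod (f z) \<le> M" and z: "cmod z < 1"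
  shows "cmod (z * deriv f z - z) + cmod (of_nat k * (f z - z)) \<le> (M - 1 / M) * tail_bound k (cmod z)"
    and "cmod (z * deriv f z - z - of_nat (k + 1) * (f z - z)) + cmod (f z - z)
           \<le> (M - 1 / M) * tail_bound k (cmod z)"
proof -
  have M: "0 < M" using bounded_disk_deriv_le[OF hol f0 bd] f1 by simp
  define a where "a n = (deriv ^^ (n + 2)) f 0 / fact (n + 2)" for n
  have a: "cmod (a n) \<le> M - 1 / M" for n
    using bounded_disk_coeff_le[OF hol f0 M bd, of "n + 2"] by (simp add: a_def f1)
  have s0: "(\<lambda>n. a n * z ^ (n + 2)) sums (f z - z)"
    and s1: "(\<lambda>n. of_nat (n + 2) * a n * z ^ (n + 2)) sums (z * deriv f z - z)"
    unfolding a_def by (rule power_series_tail[OF hol f0 f1 z])+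
  have C: "(\<lambda>n. (M - 1 / M) * ((real n + 2 + real k) * cmod z ^ (n + 2)))
      sums ((M - 1 / M) * tail_bound k (cmod z))"
    using z by (intro sums_mult tail_bound_sums) auto
  have nn: "cmod (of_nat j) = real j" for j by simp
  have coeff: "x * (cmod (a n) * cmod z ^ (n + 2))
      \<le> (M - 1 / M) * ((real n + 2 + real k) * cmod z ^ (n + 2))"
    if "0 \<le> x" "x \<le> real n + 2 + real k" for x n
  proof -
    have "x * (cmod (a n) * cmod z ^ (n + 2)) \<le> (real n + 2 + real k) * ((M - 1 / M) * cmod z ^ (n + 2))"
      using that a[of n] order_trans[OF norm_ge_zero a[of n]] by (intro mult_mono) auto
    then show ?thesis by (simp only: mult_ac)
  qed
  show "cmod (z * deriv f z - z) + cmod (of_nat k * (f z - z)) \<le> (M - 1 / M) * tail_bound k (cmod z)"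
  proof (rule norm_add_norm_sums_le[OF s1 sums_mult[OF s0] C])
    fix n
    have "cmod (of_nat (n + 2) * a n * z ^ (n + 2)) + cmod (of_nat k * (a n * z ^ (n + 2)))
        = (real (n + 2) + real k) * (cmod (a n) * cmod z ^ (n + 2))"
      by (simp only: norm_mult norm_power nn) (simp add: algebra_simps)
    also have "\<dots> \<le> (M - 1 / M) * ((real n + 2 + real k) * cmod z ^ (n + 2))"
      by (rule coeff) auto
    finally show "cmod (of_nat (n + 2) * a n * z ^ (n + 2)) + cmod (of_nat k * (a n * z ^ (n + 2)))
        \<le> (M - 1 / M) * ((real n + 2 + real k) * cmod z ^ (n + 2))" .
  qed
  show "cmod (z * deriv f z - z - of_nat (k + 1) * (f z - z)) + cmod (f z - z)
           \<le> (M - 1 / M) * tail_bound k (cmod z)"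
  proof (rule norm_add_norm_sums_le[OF sums_diff[OF s1 sums_mult[OF s0]] s0 C])
    fix n
    have "of_nat (n + 2) * a n * z ^ (n + 2) - of_nat (k + 1) * (a n * z ^ (n + 2))
        = of_real (real (n + 2) - real (k + 1)) * (a n * z ^ (n + 2))"
      by (simp add: algebra_simps)
    then have "cmod (of_nat (n + 2) * a n * z ^ (n + 2) - of_nat (k + 1) * (a n * z ^ (n + 2)))
          + cmod (a n * z ^ (n + 2))
        = (\<bar>real (n + 2) - real (k + 1)\<bar> + 1) * (cmod (a n) * cmod z ^ (n + 2))"
      by (simp only: norm_mult norm_power norm_of_real) (simp add: algebra_simps)
    also have "\<dots> \<le> (M - 1 / M) * ((real n + 2 + real k) * cmod z ^ (n + 2))"
      by (rule coeff) auto
    finally show "cmod (of_nat (n + 2) * a n * z ^ (n + 2) - of_nat (k + 1) * (a n * z ^ (n + 2)))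
          + cmod (a n * z ^ (n + 2))
        \<le> (M - 1 / M) * ((real n + 2 + real k) * cmod z ^ (n + 2))" .
  qed
qed

section \<open>The radius equation: monotonicity and existence of the root\<close>

text \<open>The identity 2 - r + k (1 - r) = 1 + (k + 1) (1 - r) splits the kernel into factors that
  visibly increase in r and match \<open>tail_bound\<close>.\<close>

lemma radius_kernel_eq:
  fixes r :: real
  assumes "r < 1"
  shows "r ^ (k + 1) * (2 - r + real k * (1 - r)) / (1 - r)\<^sup>2
    = r ^ (k + 1) * (1 / (1 - r)\<^sup>2 + (real k + 1) / (1 - r))"
proof -
  have "1 - r \<noteq> 0" using assms by simp
  then have "(2 - r + real k * (1 - r)) / (1 - r)\<^sup>2 = 1 / (1 - r)\<^sup>2 + (real k + 1) / (1 - r)"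
    by (simp add: divide_simps power2_eq_square) (simp add: algebra_simps)
  then show ?thesis
    by (simp only: times_divide_eq_right[symmetric])
qed

text \<open>The k-th summand collects all monomials cnj z^k z^n: the tail n \<ge> 2, and n = 1 with
  weight k + 1. The case k = 0, n = 1 is left out because it is the identity part z of F.\<close>

lemma radius_fun_eq_tail:
  assumes "r < 1"
  shows "r * (1 - radius_fun m M r) =
    (\<Sum>k<m. r ^ k * ((M k - 1 / M k) * tail_bound k r) + (if k = 0 then 0 else (real k + 1) * r ^ (k + 1)))"
proof -
  have "r * (\<Sum>k\<in>{1..<m}. (real k + 1) * r ^ k) = (\<Sum>k\<in>{1..<m}. (real k + 1) * r ^ (k + 1))"
    unfolding sum_distrib_left by (intro sum.cong) simp_all
  also have "\<dots> = (\<Sum>k<m. if k = 0 then 0 else (real k + 1) * r ^ (k + 1))"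
    by (rule sum.mono_neutral_cong_left) auto
  finally have 1: "r * (\<Sum>k\<in>{1..<m}. (real k + 1) * r ^ k)
      = (\<Sum>k<m. if k = 0 then 0 else (real k + 1) * r ^ (k + 1))" .
  have "r * (r ^ (k + 1) * (2 - r + real k * (1 - r)) / (1 - r)\<^sup>2) = r ^ k * tail_bound k r" for k
    unfolding radius_kernel_eq[OF assms] tail_bound_def by (simp add: power2_eq_square mult_ac)
  then have 2: "r * (\<Sum>k<m. (M k - 1 / M k) * (r ^ (k + 1) * (2 - r + real k * (1 - r)) / (1 - r)\<^sup>2))
      = (\<Sum>k<m. r ^ k * ((M k - 1 / M k) * tail_bound k r))"
    unfolding sum_distrib_left by (intro sum.cong refl) (metis mult.left_commute)
  have "r * (1 - (1 - a - b)) = r * a + r * b" for a b by (simp add: algebra_simps)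
  then show ?thesis
    unfolding radius_fun_def sum.distrib 1[symmetric] 2[symmetric] .
qed

text \<open>All subtracted terms are nondecreasing, since M_k - 1/M_k \<ge> 0. Strictness comes from
  the linear term 2 r when m \<ge> 2, and from M_0 > 1 when m = 1.\<close>

lemma radius_fun_strict_antimono:
  assumes m: "m \<ge> 1" and M: "\<And>k. k < m \<Longrightarrow> M k \<ge> 1" and ne: "\<not> (m = 1 \<and> M 0 = 1)"
    and xy: "0 \<le> x" "x < y" "y < 1"
  shows "radius_fun m M y < radius_fun m M x"
proof -
  define \<phi> where "\<phi> k r = r ^ (k + 1) * (2 - r + real k * (1 - r)) / (1 - r)\<^sup>2" for k :: nat and r :: real
  have phi: "\<phi> k r = r ^ (k + 1) * (1 / (1 - r)\<^sup>2 + (real k + 1) / (1 - r))" if "r < 1" for k r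
    unfolding \<phi>_def by (rule radius_kernel_eq[OF that])
  have phi_less: "\<phi> k x < \<phi> k y" for k
  proof -
    have "1 / (1 - x)\<^sup>2 \<le> 1 / (1 - y)\<^sup>2"
      using xy by (intro divide_left_mono power_mono mult_pos_pos) auto
    moreover have "(real k + 1) / (1 - x) \<le> (real k + 1) / (1 - y)"
      using xy by (intro divide_left_mono mult_pos_pos) auto
    moreover have "x ^ (k + 1) < y ^ (k + 1)" using xy by (intro power_strict_mono) auto
    moreover have "0 < 1 / (1 - x)\<^sup>2 + (real k + 1) / (1 - x)" using xy by (intro add_pos_pos) auto
    ultimately have "x ^ (k + 1) * (1 / (1 - x)\<^sup>2 + (real k + 1) / (1 - x))
        < y ^ (k + 1) * (1 / (1 - y)\<^sup>2 + (real k + 1) / (1 - y))"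
      using xy by (intro mult_less_le_imp_less add_mono zero_le_power) auto
    then show ?thesis using xy by (simp only: phi less_trans[OF xy(2,3)])
  qed
  have c: "M k - 1 / M k \<ge> 0" if "k < m" for k
    using M[OF that] by (smt (verit) divide_le_eq_1)
  have le: "(M k - 1 / M k) * \<phi> k x \<le> (M k - 1 / M k) * \<phi> k y" if "k < m" for k
    using c[OF that] phi_less[of k] by (intro mult_left_mono) auto
  have pw: "(real k + 1) * x ^ k \<le> (real k + 1) * y ^ k" for k
    using xy by (intro mult_left_mono power_mono) auto
  have "(\<Sum>k<m. (M k - 1 / M k) * \<phi> k x) + (\<Sum>k\<in>{1..<m}. (real k + 1) * x ^ k)
      < (\<Sum>k<m. (M k - 1 / M k) * \<phi> k y) + (\<Sum>k\<in>{1..<m}. (real k + 1) * y ^ k)"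
  proof (cases "m = 1")
    case True
    with ne M[of 0] have "M 0 > 1" by auto
    then have "M 0 - 1 / M 0 > 0" by (smt (verit) divide_less_eq_1)
    then show ?thesis using True phi_less[of 0] by simp
  next
    case False
    with m have "1 < m" by simp
    have "(\<Sum>k<m. (M k - 1 / M k) * \<phi> k x) \<le> (\<Sum>k<m. (M k - 1 / M k) * \<phi> k y)"
      by (intro sum_mono le) simp
    moreover have "(\<Sum>k\<in>{1..<m}. (real k + 1) * x ^ k) < (\<Sum>k\<in>{1..<m}. (real k + 1) * y ^ k)"
      by (rule sum_strict_mono_ex1) (use \<open>1 < m\<close> xy pw in \<open>auto intro!: bexI[of _ 1]\<close>)
    ultimately show ?thesis by linarith
  qed
  then show ?thesis unfolding radius_fun_def \<phi>_def by linarith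
qed

lemma radius_fun_zero: "radius_fun m M 0 = 1"
  by (simp add: radius_fun_def)

text \<open>The intermediate value theorem needs a function continuous up to r = 1, where the kernel
  is singular. If some M_k differs from 1, multiplying by (1 - r)^2 provides one that is negative at
  1. If all M_k equal 1, that product would vanish at 1, but the singular terms drop out and the
  remaining polynomial is used directly.\<close>

lemma radius_fun_has_root:
  assumes m: "m \<ge> 1" and M: "\<And>k. k < m \<Longrightarrow> M k \<ge> 1" and ne: "\<not> (m = 1 \<and> M 0 = 1)"
  shows "\<exists>r. 0 < r \<and> r < 1 \<and> radius_fun m M r = 0"
proof -
  have c: "M k - 1 / M k \<ge> 0" if "k < m" for k
    using M[OF that] by (smt (verit) divide_le_eq_1)
  show ?thesis
  proof (cases "\<forall>k<m. M k = 1")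
    case True
    define Q where "Q r = 1 - (\<Sum>k\<in>{1..<m}. (real k + 1) * r ^ k)" for r
    have R: "radius_fun m M r = Q r" for r by (simp add: radius_fun_def Q_def True)
    have "m \<ge> 2" using True ne m by (cases "m = 1") auto
    have "real 1 + 1 \<le> (\<Sum>k\<in>{1..<m}. real k + 1)"
      by (rule member_le_sum) (use \<open>m \<ge> 2\<close> in auto)
    then have Q1: "Q 1 < 0" by (simp add: Q_def)
    have Q0: "Q 0 = 1" by (simp add: Q_def)
    have "\<exists>r. 0 \<le> r \<and> r \<le> 1 \<and> Q r = 0"
      by (rule IVT2') (use Q0 Q1 in \<open>auto simp: Q_def intro!: continuous_intros\<close>)
    then obtain r where "0 \<le> r" "r \<le> 1" "Q r = 0" by blast
    moreover have "r \<noteq> 0" "r \<noteq> 1" using Q0 Q1 \<open>Q r = 0\<close> by auto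
    ultimately show ?thesis unfolding R by (intro exI[of _ r]) auto
  next
    case False
    then obtain j where j: "j < m" "M j \<noteq> 1" by auto
    then have "M j > 1" using M[of j] by auto
    then have cj: "M j - 1 / M j > 0" by (smt (verit) divide_less_eq_1)
    define P where "P r = (1 - r)\<^sup>2 - (\<Sum>k<m. (M k - 1 / M k) * (r ^ (k + 1) * (2 - r + real k * (1 - r))))
        - (1 - r)\<^sup>2 * (\<Sum>k\<in>{1..<m}. (real k + 1) * r ^ k)" for r
    have R: "(1 - r)\<^sup>2 * radius_fun m M r = P r" if "r < 1" for r
    proof -
      have "(1 - r)\<^sup>2 * (a * (b / (1 - r)\<^sup>2)) = a * b" for a b using that by simp
      then show ?thesis
        unfolding P_def radius_fun_def right_diff_distrib sum_distrib_left by (simp add: mult.assoc)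
    qed
    \<comment> \<open>At r = 1 each numerator r^(k+1) (2 - r + k (1 - r)) equals 1, so P(1) is minus
      the sum of the M_k - 1/M_k.\<close>
    have "M j - 1 / M j \<le> (\<Sum>k<m. M k - 1 / M k)"
      by (rule member_le_sum) (use c j in auto)
    then have P1: "P 1 < 0" using cj by (simp add: P_def)
    have P0: "P 0 = 1" by (simp add: P_def)
    have "\<exists>r. 0 \<le> r \<and> r \<le> 1 \<and> P r = 0"
      by (rule IVT2') (use P0 P1 in \<open>auto simp: P_def intro!: continuous_intros\<close>)
    then obtain r where r: "0 \<le> r" "r \<le> 1" "P r = 0" by blast
    moreover have "r \<noteq> 0" "r \<noteq> 1" using P0 P1 \<open>P r = 0\<close> by auto
    ultimately have "0 < r" "r < 1" by auto
    then show ?thesis using R[of r] r by (intro exI[of _ r]) auto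
  qed
qed

section \<open>Wirtinger derivatives of poly-analytic functions\<close>

definition polyanalytic_dz :: "nat \<Rightarrow> (nat \<Rightarrow> complex \<Rightarrow> complex) \<Rightarrow> complex \<Rightarrow> complex" where
  "polyanalytic_dz m f z = (\<Sum>k<m. cnj z ^ k * deriv (f k) z)"

definition polyanalytic_dzbar :: "nat \<Rightarrow> (nat \<Rightarrow> complex \<Rightarrow> complex) \<Rightarrow> complex \<Rightarrow> complex" where
  "polyanalytic_dzbar m f z = (\<Sum>k<m. of_nat k * cnj z ^ (k - 1) * f k z)"

text \<open>Multiplication by cnj z removes the truncated exponent \<open>k - 1\<close>; at k = 0
  the factor k is zero on both sides.\<close>

lemma cnj_mult_polyanalytic_dzbar:
  "cnj z * polyanalytic_dzbar m f z = (\<Sum>k<m. of_nat k * cnj z ^ k * f k z)"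
  unfolding polyanalytic_dzbar_def sum_distrib_left
proof (rule sum.cong)
  show "cnj z * (of_nat k * cnj z ^ (k - 1) * f k z) = of_nat k * cnj z ^ k * f k z" for k
    by (cases k) auto
qed auto

lemma polyanalytic_has_derivative:
  assumes S: "open S" "z \<in> S" and hol: "\<And>k. k < m \<Longrightarrow> f k holomorphic_on S"
    and F: "\<And>w. w \<in> S \<Longrightarrow> F w = (\<Sum>k<m. cnj w ^ k * f k w)"
  shows "(F has_derivative (\<lambda>h. polyanalytic_dz m f z * h + polyanalytic_dzbar m f z * cnj h)) (at z)"
proof -
  have cnj: "(cnj has_derivative cnj) (at z)"
    using bounded_linear_cnj by (rule bounded_linear_imp_has_derivative)
  have "((\<lambda>w. \<Sum>k<m. cnj w ^ k * f k w) has_derivative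
      (\<lambda>h. \<Sum>k<m. cnj z ^ k * (deriv (f k) z * h) + of_nat k * cnj h * cnj z ^ (k - 1) * f k z)) (at z)"
  proof (rule has_derivative_sum)
    fix k assume "k \<in> {..<m}"
    then have "(f k has_field_derivative deriv (f k) z) (at z)"
      using hol S by (intro holomorphic_derivI) auto
    then have "(f k has_derivative (*) (deriv (f k) z)) (at z)"
      by (simp add: has_field_derivative_def)
    from has_derivative_mult[OF has_derivative_power[OF cnj] this]
    show "((\<lambda>w. cnj w ^ k * f k w) has_derivative
      (\<lambda>h. cnj z ^ k * (deriv (f k) z * h) + of_nat k * cnj h * cnj z ^ (k - 1) * f k z)) (at z)" .
  qed
  also have "(\<lambda>h. \<Sum>k<m. cnj z ^ k * (deriv (f k) z * h) + of_nat k * cnj h * cnj z ^ (k - 1) * f k z)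
      = (\<lambda>h. polyanalytic_dz m f z * h + polyanalytic_dzbar m f z * cnj h)"
    by (simp add: polyanalytic_dz_def polyanalytic_dzbar_def sum_distrib_left sum.distrib mult_ac)
  finally show ?thesis
    by (rule has_derivative_transform_within_open[OF _ S]) (simp add: F)
qed

text \<open>The coefficients of h and cnj h in a real-linear derivative are its Wirtinger
  derivatives: evaluation at 1 and \<i> gives a + b and \<i> (a - b).\<close>

lemma wirtinger_eqI:
  assumes "(F has_derivative (\<lambda>h. a * h + b * cnj h)) (at z)"
  shows "wirtinger_z F z = a" "wirtinger_zbar F z = b"
    "frechet_derivative F (at z) 1 = a + b" "frechet_derivative F (at z) \<i> = \<i> * (a - b)"
proof -
  have eq: "frechet_derivative F (at z) = (\<lambda>h. a * h + b * cnj h)"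
    using frechet_derivative_at[OF assms] by simp
  show "wirtinger_z F z = a" "wirtinger_zbar F z = b"
    "frechet_derivative F (at z) 1 = a + b" "frechet_derivative F (at z) \<i> = \<i> * (a - b)"
    unfolding wirtinger_z_def wirtinger_zbar_def eq by (simp_all add: algebra_simps)
qed

section \<open>How far F deviates from the identity\<close>

text \<open>The normalisation f_k'(0) = 1 includes k = 0 here; the theorem derives that case from
  F_z(0) = 1.\<close>

locale bounded_polyanalytic =
  fixes m :: nat and M :: "nat \<Rightarrow> real"
    and F :: "complex \<Rightarrow> complex" and f :: "nat \<Rightarrow> complex \<Rightarrow> complex"
  assumes m: "m \<ge> 1"
    and hol: "\<And>k. k < m \<Longrightarrow> f k holomorphic_on ball 0 1"
    and F_eq: "\<And>z. z \<in> ball 0 1 \<Longrightarrow> F z = (\<Sum>k<m. cnj z ^ k * f k z)"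
    and f_zero: "\<And>k. k < m \<Longrightarrow> f k 0 = 0"
    and deriv_f_zero: "\<And>k. k < m \<Longrightarrow> deriv (f k) 0 = 1"
    and f_bound: "\<And>k z. k < m \<Longrightarrow> z \<in> ball 0 1 \<Longrightarrow> cmod (f k z) \<le> M k"
begin

lemma one_le_bound: "k < m \<Longrightarrow> 1 \<le> M k"
  using bounded_disk_deriv_le[OF hol f_zero f_bound] deriv_f_zero[of k] by fastforce

lemma F_has_derivative:
  "cmod z < 1 \<Longrightarrow>
    (F has_derivative (\<lambda>h. polyanalytic_dz m f z * h + polyanalytic_dzbar m f z * cnj h)) (at z)"
  by (rule polyanalytic_has_derivative[of "ball 0 1"]) (auto simp: hol F_eq)

lemmas wirtinger_F = wirtinger_eqI[OF F_has_derivative]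

lemma cont_differentiable_F: "cont_differentiable_on F (ball 0 1)"
proof -
  have ch: "continuous_on (ball 0 1) (f k)" "continuous_on (ball 0 1) (deriv (f k))" if "k < m" for k
    using hol[OF that] by (auto intro!: holomorphic_on_imp_continuous_on holomorphic_deriv)
  have c: "continuous_on (ball 0 1) (polyanalytic_dz m f)"
       "continuous_on (ball 0 1) (polyanalytic_dzbar m f)"
    unfolding polyanalytic_dz_def polyanalytic_dzbar_def
    by (auto intro!: continuous_intros ch)
  have "continuous_on (ball 0 1) (\<lambda>z. frechet_derivative F (at z) 1)"
    by (rule continuous_on_eq[OF continuous_on_add[OF c]]) (simp add: wirtinger_F)
  moreover have "continuous_on (ball 0 1) (\<lambda>z. frechet_derivative F (at z) \<i>)"
    by (rule continuous_on_eq[OF continuous_on_mult[OF continuous_on_const[of _ \<i>] continuous_on_diff[OF c]]])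
      (simp add: wirtinger_F)
  ultimately show ?thesis
    unfolding cont_differentiable_on_def differentiable_def
    using F_has_derivative by (auto intro!: exI)
qed

text \<open>The termwise majorant is exactly the k-th summand in \<open>radius_fun_eq_tail\<close>,
  so each deviation estimate reduces to a single k.\<close>

lemma sum_tail_le:
  assumes z: "cmod z < 1"
    and le: "\<And>k. k < m \<Longrightarrow> cmod (u k) + cmod (v k)
      \<le> cmod z ^ k * ((M k - 1 / M k) * tail_bound k (cmod z)) + (if k = 0 then 0 else (real k + 1) * cmod z ^ (k + 1))"
  shows "cmod (\<Sum>k<m. u k) + cmod (\<Sum>k<m. v k) \<le> cmod z * (1 - radius_fun m M (cmod z))"
proof -
  have "cmod (\<Sum>k<m. u k) + cmod (\<Sum>k<m. v k) \<le> (\<Sum>k<m. cmod (u k)) + (\<Sum>k<m. cmod (v k))"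
    by (intro add_mono norm_sum)
  also have "\<dots> = (\<Sum>k<m. cmod (u k) + cmod (v k))" by (simp add: sum.distrib)
  also have "\<dots> \<le> cmod z * (1 - radius_fun m M (cmod z))"
    unfolding radius_fun_eq_tail[OF z] by (intro sum_mono le) simp
  finally show ?thesis .
qed

lemma tail_estimates:
  assumes "k < m" "cmod z < 1"
  shows "cmod (z * deriv (f k) z - z) + cmod (of_nat k * (f k z - z))
           \<le> (M k - 1 / M k) * tail_bound k (cmod z)"
    and "cmod (z * deriv (f k) z - z - of_nat (k + 1) * (f k z - z)) + cmod (f k z - z)
           \<le> (M k - 1 / M k) * tail_bound k (cmod z)"
  by (rule bounded_disk_tail_estimates; use assms hol f_zero deriv_f_zero f_bound in auto)+

lemma sum_minus_first: "(\<Sum>k<m. g k) - z = (\<Sum>k<m. g k - (if k = 0 then z else 0))"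
  for g :: "nat \<Rightarrow> complex"
  using m by (simp add: sum_subtractf)

text \<open>After multiplication by |z| both norms are sums over k. Splitting f_k into z and its
  tail, the tail is covered by \<open>tail_estimates\<close>, and cnj z^k z with k \<ge> 1
  contributes (1 + k) |z|^(k+1). Since |z| is cancelled at the end, z = 0 is checked
  directly.\<close>

lemma derivative_deviation:
  assumes z: "cmod z < 1"
  shows "cmod (polyanalytic_dz m f z - 1) + cmod (polyanalytic_dzbar m f z)
    \<le> 1 - radius_fun m M (cmod z)"
proof (cases "z = 0")
  case True
  have "polyanalytic_dz m f 0 = (\<Sum>k<m. if k = 0 then 1 else 0)"
    unfolding polyanalytic_dz_def by (intro sum.cong) (auto simp: deriv_f_zero)
  then have "polyanalytic_dz m f 0 = 1" using m by simp
  moreover have "polyanalytic_dzbar m f 0 = 0"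
    unfolding polyanalytic_dzbar_def by (intro sum.neutral) (auto simp: f_zero)
  ultimately show ?thesis using True m by (simp add: radius_fun_zero)
next
  case False
  define r where "r = cmod z"
  have r: "0 < r" "r < 1" using False z by (auto simp: r_def)
  have "z * polyanalytic_dz m f z = (\<Sum>k<m. cnj z ^ k * (z * deriv (f k) z))"
    by (simp add: polyanalytic_dz_def sum_distrib_left mult_ac)
  then have A: "z * (polyanalytic_dz m f z - 1)
      = (\<Sum>k<m. cnj z ^ k * (z * deriv (f k) z) - (if k = 0 then z else 0))"
    by (simp add: sum_minus_first[symmetric] algebra_simps)
  note B = cnj_mult_polyanalytic_dzbar[of z m f]
  have "cmod (z * (polyanalytic_dz m f z - 1)) + cmod (cnj z * polyanalytic_dzbar m f z)
      \<le> r * (1 - radius_fun m M r)"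
    unfolding A B r_def
  proof (rule sum_tail_le[OF z])
    fix k assume k: "k < m"
    define p q where "p = z * deriv (f k) z - z" and "q = of_nat k * (f k z - z)"
    have E: "cmod p + cmod q \<le> (M k - 1 / M k) * tail_bound k (cmod z)"
      unfolding p_def q_def by (rule tail_estimates[OF k z])
    have 1: "cnj z ^ k * (z * deriv (f k) z) - (if k = 0 then z else 0)
        = cnj z ^ k * p + (if k = 0 then 0 else cnj z ^ k * z)"
      and 2: "of_nat k * cnj z ^ k * f k z = cnj z ^ k * q + of_nat k * (cnj z ^ k * z)"
      by (auto simp: p_def q_def algebra_simps)
    have "cmod (cnj z ^ k * (z * deriv (f k) z) - (if k = 0 then z else 0))
        \<le> cmod z ^ k * cmod p + (if k = 0 then 0 else cmod z ^ (k + 1))"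
      unfolding 1 by (rule order_trans[OF norm_triangle_ineq]) (simp add: norm_mult norm_power)
    moreover have "cmod (of_nat k * cnj z ^ k * f k z) \<le> cmod z ^ k * cmod q + real k * cmod z ^ (k + 1)"
      unfolding 2 by (rule order_trans[OF norm_triangle_ineq]) (simp add: norm_mult norm_power)
    moreover have "cmod z ^ k * (cmod p + cmod q) \<le> cmod z ^ k * ((M k - 1 / M k) * tail_bound k (cmod z))"
      by (intro mult_left_mono E) auto
    ultimately show "cmod (cnj z ^ k * (z * deriv (f k) z) - (if k = 0 then z else 0)) +
        cmod (of_nat k * cnj z ^ k * f k z)
      \<le> cmod z ^ k * ((M k - 1 / M k) * tail_bound k (cmod z)) +
        (if k = 0 then 0 else (real k + 1) * cmod z ^ (k + 1))"
      by (cases "k = 0"; simp only: distrib_left distrib_right if_True if_False of_nat_0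
        mult_zero_left mult_1 simp_thms; linarith)
  qed
  then have "r * (cmod (polyanalytic_dz m f z - 1) + cmod (polyanalytic_dzbar m f z))
      \<le> r * (1 - radius_fun m M r)"
    by (simp only: norm_mult r_def distrib_left complex_mod_cnj)
  then show ?thesis using r by (simp add: r_def)
qed

text \<open>The first expression multiplies the monomial cnj z^k z^n by n - k - 1. For n = 1 this is
  -k, and together with the 1 from F - z the weight is again k + 1 for k \<ge> 1 and 0 for k =
  0.\<close>

lemma starlike_deviation:
  assumes z: "cmod z < 1"
  shows "cmod (z * polyanalytic_dz m f z - cnj z * polyanalytic_dzbar m f z - F z) + cmod (F z - z)
    \<le> cmod z * (1 - radius_fun m M (cmod z))"
proof -
  have F: "F z = (\<Sum>k<m. cnj z ^ k * f k z)" using z by (simp add: F_eq)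
  note B = cnj_mult_polyanalytic_dzbar[of z m f]
  have A: "z * polyanalytic_dz m f z - cnj z * polyanalytic_dzbar m f z - F z
      = (\<Sum>k<m. cnj z ^ k * (z * deriv (f k) z - of_nat (k + 1) * f k z))"
    unfolding B F by (simp add: polyanalytic_dz_def sum_distrib_left sum_subtractf[symmetric] algebra_simps)
  have C: "F z - z = (\<Sum>k<m. cnj z ^ k * f k z - (if k = 0 then z else 0))"
    unfolding F by (rule sum_minus_first)
  show ?thesis unfolding A C
  proof (rule sum_tail_le[OF z])
    fix k assume k: "k < m"
    define p q where "p = z * deriv (f k) z - z - of_nat (k + 1) * (f k z - z)" and "q = f k z - z"
    have E: "cmod p + cmod q \<le> (M k - 1 / M k) * tail_bound k (cmod z)"
      unfolding p_def q_def by (rule tail_estimates[OF k z])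
    have 1: "cnj z ^ k * (z * deriv (f k) z - of_nat (k + 1) * f k z)
        = cnj z ^ k * p - of_nat k * (cnj z ^ k * z)"
      and 2: "cnj z ^ k * f k z - (if k = 0 then z else 0)
        = cnj z ^ k * q + (if k = 0 then 0 else cnj z ^ k * z)"
      by (auto simp: p_def q_def algebra_simps)
    have "cmod (cnj z ^ k * (z * deriv (f k) z - of_nat (k + 1) * f k z))
        \<le> cmod z ^ k * cmod p + real k * cmod z ^ (k + 1)"
      unfolding 1 by (rule order_trans[OF norm_triangle_ineq4]) (simp add: norm_mult norm_power)
    moreover have "cmod (cnj z ^ k * f k z - (if k = 0 then z else 0))
        \<le> cmod z ^ k * cmod q + (if k = 0 then 0 else cmod z ^ (k + 1))"
      unfolding 2 by (rule order_trans[OF norm_triangle_ineq]) (simp add: norm_mult norm_power)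
    moreover have "cmod z ^ k * (cmod p + cmod q) \<le> cmod z ^ k * ((M k - 1 / M k) * tail_bound k (cmod z))"
      by (intro mult_left_mono E) auto
    ultimately show "cmod (cnj z ^ k * (z * deriv (f k) z - of_nat (k + 1) * f k z)) +
        cmod (cnj z ^ k * f k z - (if k = 0 then z else 0))
      \<le> cmod z ^ k * ((M k - 1 / M k) * tail_bound k (cmod z)) +
        (if k = 0 then 0 else (real k + 1) * cmod z ^ (k + 1))"
      by (cases "k = 0"; simp only: distrib_left distrib_right if_True if_False of_nat_0
        mult_zero_left mult_1 simp_thms; linarith)
  qed
qed

section \<open>Geometry of F inside the disk given by a root\<close>

context
  fixes R :: real
  assumes R: "0 < R" "R < 1" "radius_fun m M R = 0"
begin

lemma nontrivial: "\<not> (m = 1 \<and> M 0 = 1)"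
  using R(3) by (auto simp: radius_fun_def)

lemma radius_fun_antimono: "0 \<le> x \<Longrightarrow> x \<le> y \<Longrightarrow> y \<le> R \<Longrightarrow> radius_fun m M y \<le> radius_fun m M x"
  using radius_fun_strict_antimono[where m = m and M = M, OF m one_le_bound nontrivial, of x y] R by (cases "x = y") auto

lemma radius_fun_pos: "0 \<le> x \<Longrightarrow> x < R \<Longrightarrow> 0 < radius_fun m M x"
  using radius_fun_strict_antimono[where m = m and M = M, OF m one_le_bound nontrivial, of x R] R by auto

text \<open>Below the root |F_z - 1| + |F_zbar| < 1, hence |F_zbar| < 1 - |F_z - 1| \<le>
  |F_z|.\<close>

lemma sense_preserving_F: "sense_preserving_on F (ball 0 R)"
  unfolding sense_preserving_on_def
proof (intro conjI ballI)
  have "ball 0 R \<subseteq> (ball 0 1 :: complex set)" using R by auto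
  then show "cont_differentiable_on F (ball 0 R)"
    using cont_differentiable_F unfolding cont_differentiable_on_def
    by (meson continuous_on_subset subsetD)
  fix z :: complex assume "z \<in> ball 0 R"
  then have z: "cmod z < R" "cmod z < 1" using R by auto
  have "cmod (polyanalytic_dz m f z - 1) + cmod (polyanalytic_dzbar m f z) < 1"
    using derivative_deviation[OF z(2)] radius_fun_pos[of "cmod z"] z by simp
  moreover have "1 - cmod (polyanalytic_dz m f z - 1) \<le> cmod (polyanalytic_dz m f z)"
    by (smt (verit) norm_minus_commute norm_one norm_triangle_ineq2)
  ultimately have "cmod (polyanalytic_dzbar m f z) < cmod (polyanalytic_dz m f z)" by linarith
  then show "jacobian_det F z > 0"
    unfolding jacobian_det_def wirtinger_F[OF z(2)] by (simp add: power_strict_mono)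
qed

text \<open>Positivity of \<open>radius_fun\<close> makes the sum in
  \<open>starlike_deviation\<close> smaller than |z|; moving |F - z| to the right leaves |z| - |F -
  z| \<le> |F|.\<close>

lemma F_near_identity:
  assumes z: "z \<noteq> 0" "cmod z < R"
  shows "F z \<noteq> 0"
    and "cmod (z * polyanalytic_dz m f z - cnj z * polyanalytic_dzbar m f z - F z) < cmod (F z)"
proof -
  have "0 < cmod z * radius_fun m M (cmod z)"
    using z by (intro mult_pos_pos radius_fun_pos) auto
  moreover have "cmod (z * polyanalytic_dz m f z - cnj z * polyanalytic_dzbar m f z - F z) + cmod (F z - z)
    \<le> cmod z * (1 - radius_fun m M (cmod z))"
    using z R by (intro starlike_deviation) auto
  moreover have "cmod z - cmod (F z - z) \<le> cmod (F z)"
    by (smt (verit) norm_minus_commute norm_triangle_ineq2)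
  ultimately show *: "cmod (z * polyanalytic_dz m f z - cnj z * polyanalytic_dzbar m f z - F z) < cmod (F z)"
    by (simp add: right_diff_distrib)
  show "F z \<noteq> 0"
    using * norm_ge_zero[of "z * polyanalytic_dz m f z - cnj z * polyanalytic_dzbar m f z - F z"] by auto
qed

lemma fully_starlike_F: "fully_starlike F R"
  unfolding fully_starlike_def
proof (intro conjI allI impI ballI)
  show "sense_preserving_on F (ball 0 R)" by (rule sense_preserving_F)
  show "F 0 = 0" by (simp add: F_eq f_zero)
  show "F z \<noteq> 0" if "z \<in> ball 0 R - {0}" for z using F_near_identity(1)[of z] that by auto
  fix \<rho> t :: real assume \<rho>: "0 < \<rho> \<and> \<rho> < R"
  define z where "z = complex_of_real \<rho> * cis t"
  have z: "z \<noteq> 0" "cmod z < R" using \<rho> by (auto simp: z_def norm_mult)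
  then have z1: "cmod z < 1" using R by simp
  define N where "N = z * polyanalytic_dz m f z - cnj z * polyanalytic_dzbar m f z"
  have "cmod (N - F z) < cmod (F z)" "F z \<noteq> 0"
    using F_near_identity[OF z] by (simp_all add: N_def)
  \<comment> \<open>The quotient N / F lies in the open unit disk about 1, hence in the right
    half-plane.\<close>
  then have "cmod ((N - F z) / F z) < 1" by (simp add: norm_divide)
  moreover have "(N - F z) / F z = N / F z - 1" using \<open>F z \<noteq> 0\<close> by (simp add: diff_divide_distrib)
  ultimately have "Re (N / F z) > 0"
    using abs_Re_le_cmod[of "N / F z - 1"] by simp
  then show "let z = complex_of_real \<rho> * cis t
      in Re ((z * wirtinger_z F z - cnj z * wirtinger_zbar F z) / F z) > 0"
    unfolding Let_def z_def[symmetric] wirtinger_F[OF z1] N_def .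
qed

text \<open>On a closed disk of radius \<rho> < R the map F - id has Lipschitz constant 1 -
  \<open>radius_fun m M \<rho>\<close> < 1. If F x = F y, its increment has modulus |x - y|, which
  forces x = y.\<close>

lemma inj_on_F: "inj_on F (ball 0 R)"
proof (rule inj_onI)
  fix x y :: complex assume xy: "x \<in> ball 0 R" "y \<in> ball 0 R" "F x = F y"
  define \<rho> where "\<rho> = max (cmod x) (cmod y)"
  have \<rho>: "0 \<le> \<rho>" "\<rho> < R" using xy by (auto simp: \<rho>_def le_max_iff_disj)
  have "cmod ((F x - x) - (F y - y)) \<le> (1 - radius_fun m M \<rho>) * cmod (x - y)"
  proof (rule differentiable_bound[where S = "cball 0 \<rho>"])
    fix z :: complex assume "z \<in> cball 0 \<rho>"
    then have z: "cmod z \<le> \<rho>" "cmod z < 1" using \<rho> R by auto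
    let ?a = "polyanalytic_dz m f z - 1" and ?b = "polyanalytic_dzbar m f z"
    have "((\<lambda>z. F z - z) has_derivative
        (\<lambda>h. polyanalytic_dz m f z * h + polyanalytic_dzbar m f z * cnj h - h)) (at z)"
      by (intro has_derivative_diff F_has_derivative z has_derivative_ident)
    then show "((\<lambda>z. F z - z) has_derivative (\<lambda>h. ?a * h + ?b * cnj h)) (at z within cball 0 \<rho>)"
      by (simp add: algebra_simps has_derivative_at_withinI)
    have "cmod (?a * h + ?b * cnj h) \<le> (cmod ?a + cmod ?b) * cmod h" for h
      by (rule order_trans[OF norm_triangle_ineq]) (simp only: norm_mult complex_mod_cnj distrib_right order_refl)
    then have "onorm (\<lambda>h. ?a * h + ?b * cnj h) \<le> cmod ?a + cmod ?b"
      by (intro onorm_le)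
    also have "\<dots> \<le> 1 - radius_fun m M (cmod z)" by (rule derivative_deviation[OF z(2)])
    also have "\<dots> \<le> 1 - radius_fun m M \<rho>" using radius_fun_antimono[of "cmod z" \<rho>] z \<rho> by simp
    finally show "onorm (\<lambda>h. ?a * h + ?b * cnj h) \<le> 1 - radius_fun m M \<rho>" .
  qed (auto simp: \<rho>_def)
  then have "cmod (x - y) \<le> (1 - radius_fun m M \<rho>) * cmod (x - y)"
    using xy by (simp add: norm_minus_commute)
  then have "radius_fun m M \<rho> * cmod (x - y) \<le> 0" by (simp add: algebra_simps)
  then have "cmod (x - y) \<le> 0" using radius_fun_pos[OF \<rho>] by (simp add: mult_le_0_iff)
  then show "x = y" by simp
qed

end

end

theorem theorem3p3:
  fixes m :: nat and M :: "nat \<Rightarrow> real"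
    and F :: "complex \<Rightarrow> complex" and f :: "nat \<Rightarrow> complex \<Rightarrow> complex"
  assumes "m \<ge> 1"
    and "\<And>k. k < m \<Longrightarrow> M k \<ge> 0"
    and "\<And>k. k < m \<Longrightarrow> f k holomorphic_on ball 0 1"
    and "\<And>z. z \<in> ball 0 1 \<Longrightarrow> F z = (\<Sum>k<m. cnj z ^ k * f k z)"
    and "wirtinger_z F 0 = 1"
    and "\<And>k. k < m \<Longrightarrow> f k 0 = 0"
    and "\<And>k. 1 \<le> k \<Longrightarrow> k < m \<Longrightarrow> deriv (f k) 0 = 1"
    and "\<And>k z. k < m \<Longrightarrow> z \<in> ball 0 1 \<Longrightarrow> cmod (f k z) \<le> M k"
  shows "(\<forall>k<m. M k \<ge> 1) \<and>
    (\<not> (m = 1 \<and> M 0 = 1) \<longrightarrow> (\<exists>!r. 0 < r \<and> r < 1 \<and> radius_fun m M r = 0)) \<and>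
    (\<forall>r4. 0 < r4 \<and> r4 < 1 \<and> radius_fun m M r4 = 0 \<longrightarrow>
       sense_preserving_on F (ball 0 r4) \<and>
       inj_on F (ball 0 r4) \<and>
       fully_starlike F r4)"
proof -
  \<comment> \<open>At the origin only the k = 0 term survives, so F_z(0) = f_0'(0); this supplies
    the normalisation missing for k = 0.\<close>
  have "wirtinger_z F 0 = polyanalytic_dz m f 0"
    by (rule wirtinger_eqI(1), rule polyanalytic_has_derivative[of "ball 0 1"]) (use assms in auto)
  also have "\<dots> = (\<Sum>k<m. if k = 0 then deriv (f 0) 0 else 0)"
    unfolding polyanalytic_dz_def by (intro sum.cong) auto
  also have "\<dots> = deriv (f 0) 0" using \<open>m \<ge> 1\<close> by simp
  finally have d0: "deriv (f 0) 0 = 1" using assms(5) by simp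
  have d: "deriv (f k) 0 = 1" if "k < m" for k
    using d0 assms(7)[of k] that by (cases "k = 0") auto
  interpret bounded_polyanalytic m M F f
    by unfold_locales (use assms d in auto)
  have "\<exists>!r. 0 < r \<and> r < 1 \<and> radius_fun m M r = 0" if ne: "\<not> (m = 1 \<and> M 0 = 1)"
  proof (rule ex_ex1I)
    show "\<exists>r. 0 < r \<and> r < 1 \<and> radius_fun m M r = 0"
      by (rule radius_fun_has_root[where m = m and M = M, OF m one_le_bound ne])
    fix r s assume "0 < r \<and> r < 1 \<and> radius_fun m M r = 0" "0 < s \<and> s < 1 \<and> radius_fun m M s = 0"
    then show "r = s"
      using radius_fun_strict_antimono[where m = m and M = M, OF m one_le_bound ne, of r s]
        radius_fun_strict_antimono[where m = m and M = M, OF m one_le_bound ne, of s r]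
      by linarith
  qed
  moreover have "sense_preserving_on F (ball 0 r) \<and> inj_on F (ball 0 r) \<and> fully_starlike F r"
    if "0 < r \<and> r < 1 \<and> radius_fun m M r = 0" for r
    using that sense_preserving_F[of r] inj_on_F[of r] fully_starlike_F[of r] by simp
  ultimately show ?thesis
    using one_le_bound by simp
qed

end
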